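(* Let $G$ be a bridgeless cubic graph, let $M$ be a perfect matching of $G$, and let $\mathcal M=\{A,B,C,D\}$ be an F-family for $M$. Then $G$ has a Fulkerson covering.
   Context: A Fulkerson covering of $G$ is a family of $6$ perfect matchings of $G$ (not necessarily distinct) such that every edge lies in exactly two of them. Let $M$ be a perfect matching of $G$; the cycles of $G\setminus M$ are the cycles of the $2$-factor obtained by deleting the edges of $M$. A set $X\subseteq E(G)$ is an $M$-balanced matching if there is a perfect matching $M_X$ of $G$ with $X=M\cap M_X$. Four pairwise disjoint $M$-balanced matchings $\mathcal M=\{A,B,C,D\}$ form an F-family for $M$ if: (i) for every odd cycle $\Gamma$ of $G\setminus M$ and every $X\in\mathcal M$, exactly one vertex of $\Gamma$ is incident with an edge of $X$ (so $\Gamma$ has exactly four vertices incident with edges of $A\cup B\cup C\cup D$, one for each member); (ii) every even cycle $\Gamma$ of $G\setminus M$ having a vertex incident with an edge of $A\cup B\cup C\cup D$ has exactly four such vertices, and either two of them are incident with edges of one member of $\mathcal M$ and the other two with edges of another member of $\mathcal M$, or all four are incident with edges of the same member of $\mathcal M$; (iii) for every cycle $\Gamma$ of $G\setminus M$ as in (i) or (ii), the subgraph of $G$ induced by the four vertices so determined has a perfect matching (a matching with two edges covering these four vertices). The set of edges of these chosen two-edge matchings, over all such cycles, is denoted $N$. *)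

theory Defs
  imports Main
begin

text \<open>Finite undirected graphs with parallel edges allowed. Loops are excluded: a cubic graph
  with a loop has a bridge, so they cannot occur in a bridgeless cubic graph.\<close>

record ('v, 'e) graph =
  verts :: "'v set"
  edges :: "'e set"
  ends :: "'e \<Rightarrow> 'v set"

definition wf_graph :: "('v, 'e) graph \<Rightarrow> bool" where
  "wf_graph G \<longleftrightarrow> finite (verts G) \<and> finite (edges G) \<and>
     (\<forall>e\<in>edges G. ends G e \<subseteq> verts G \<and> card (ends G e) = 2)"

definition cubic :: "('v, 'e) graph \<Rightarrow> bool" where
  "cubic G \<longleftrightarrow> (\<forall>v\<in>verts G. card {e \<in> edges G. v \<in> ends G e} = 3)"

definition delete_edges :: "('v, 'e) graph \<Rightarrow> 'e set \<Rightarrow> ('v, 'e) graph" where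
  "delete_edges G F = G\<lparr>edges := edges G - F\<rparr>"

definition induced_subgraph :: "('v, 'e) graph \<Rightarrow> 'v set \<Rightarrow> ('v, 'e) graph" where
  "induced_subgraph G S =
     G\<lparr>verts := verts G \<inter> S, edges := {e \<in> edges G. ends G e \<subseteq> S}\<rparr>"

definition connected_rel :: "('v, 'e) graph \<Rightarrow> ('v \<times> 'v) set" where
  "connected_rel G =
     (verts G \<times> verts G) \<inter> {(u, v). \<exists>e\<in>edges G. ends G e = {u, v}}\<^sup>*"

definition components :: "('v, 'e) graph \<Rightarrow> 'v set set" where
  "components G = verts G // connected_rel G"

definition bridge :: "('v, 'e) graph \<Rightarrow> 'e \<Rightarrow> bool" where
  "bridge G e \<longleftrightarrow>
     e \<in> edges G \<and> card (components (delete_edges G {e})) > card (components G)"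

definition bridgeless :: "('v, 'e) graph \<Rightarrow> bool" where
  "bridgeless G \<longleftrightarrow> \<not> (\<exists>e. bridge G e)"

definition perfect_matching :: "('v, 'e) graph \<Rightarrow> 'e set \<Rightarrow> bool" where
  "perfect_matching G P \<longleftrightarrow>
     P \<subseteq> edges G \<and> (\<forall>v\<in>verts G. \<exists>!e. e \<in> P \<and> v \<in> ends G e)"

definition fulkerson_covering :: "('v, 'e) graph \<Rightarrow> (nat \<Rightarrow> 'e set) \<Rightarrow> bool" where
  "fulkerson_covering G P \<longleftrightarrow>
     (\<forall>i<6. perfect_matching G (P i)) \<and>
     (\<forall>e\<in>edges G. card {i. i < 6 \<and> e \<in> P i} = 2)"

text \<open>A cycle is given by its vertices \<open>vs\<close> and edges \<open>es\<close> in cyclic order, the edge \<open>es ! i\<close>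
  joining \<open>vs ! i\<close> to its successor. Two parallel edges form a cycle of length 2.\<close>

definition is_cycle :: "('v, 'e) graph \<Rightarrow> 'v list \<Rightarrow> 'e list \<Rightarrow> bool" where
  "is_cycle G vs es \<longleftrightarrow>
     length vs \<ge> 2 \<and> length es = length vs \<and> distinct vs \<and> distinct es \<and>
     set vs \<subseteq> verts G \<and> set es \<subseteq> edges G \<and>
     (\<forall>i<length vs. ends G (es ! i) = {vs ! i, vs ! (Suc i mod length vs)})"

definition balanced_matching :: "('v, 'e) graph \<Rightarrow> 'e set \<Rightarrow> 'e set \<Rightarrow> bool" where
  "balanced_matching G M X \<longleftrightarrow> (\<exists>MX. perfect_matching G MX \<and> X = M \<inter> MX)"

definition covered :: "('v, 'e) graph \<Rightarrow> 'e set \<Rightarrow> 'v set" where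
  "covered G X = (\<Union>e\<in>X. ends G e)"

text \<open>Members of the family may be empty, so that \<open>{A, B, C, D}\<close> may have fewer than four
  elements. Where two distinct members \<open>X\<close>, \<open>Y\<close> are required below, both are nonempty, hence
  distinct as sets.\<close>

definition F_family ::
  "('v, 'e) graph \<Rightarrow> 'e set \<Rightarrow> 'e set \<Rightarrow> 'e set \<Rightarrow> 'e set \<Rightarrow> 'e set \<Rightarrow> bool" where
  "F_family G M A B C D \<longleftrightarrow>
     (\<forall>X\<in>{A, B, C, D}. balanced_matching G M X) \<and>
     A \<inter> B = {} \<and> A \<inter> C = {} \<and> A \<inter> D = {} \<and> B \<inter> C = {} \<and> B \<inter> D = {} \<and> C \<inter> D = {} \<and>
     (\<forall>vs es. is_cycle (delete_edges G M) vs es \<and> odd (length vs) \<longrightarrow>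
        (\<forall>X\<in>{A, B, C, D}. card (set vs \<inter> covered G X) = 1)) \<and>
     (\<forall>vs es. is_cycle (delete_edges G M) vs es \<and> even (length vs) \<and>
          set vs \<inter> covered G (A \<union> B \<union> C \<union> D) \<noteq> {} \<longrightarrow>
        card (set vs \<inter> covered G (A \<union> B \<union> C \<union> D)) = 4 \<and>
        ((\<exists>X\<in>{A, B, C, D}. \<exists>Y\<in>{A, B, C, D}. X \<noteq> Y \<and>
            card (set vs \<inter> covered G X) = 2 \<and> card (set vs \<inter> covered G Y) = 2) \<or>
         (\<exists>X\<in>{A, B, C, D}. card (set vs \<inter> covered G X) = 4))) \<and>
     (\<forall>vs es. is_cycle (delete_edges G M) vs es \<and>
          (odd (length vs) \<or> set vs \<inter> covered G (A \<union> B \<union> C \<union> D) \<noteq> {}) \<longrightarrow>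
        (\<exists>N. perfect_matching
               (induced_subgraph G (set vs \<inter> covered G (A \<union> B \<union> C \<union> D))) N))"

end

theory Submission imports Defs begin

text \<open>
  Let \<open>U\<close> be the union of the members \<open>F 0, \<dots>, F 3\<close> of the F-family. The covering consists of \<open>M\<close>, of
  \<open>(M - U) \<union> N\<close>, and of four perfect matchings \<open>(F k - N) \<union> Q k\<close>, where \<open>Q k\<close> is chosen separately
  on each cycle of \<open>G \ M\<close>. Every edge of \<open>M\<close> is then covered twice, whatever the choices.
  For an edge \<open>e\<close> of a cycle let \<open>s e\<close> be the number of \<open>Q k\<close> containing \<open>e\<close>, plus one if \<open>e \<in> N\<close>.
  Counting degrees at a vertex shows that \<open>s\<close> sums to 4 over any two consecutive edges of the cycle.
  On an odd cycle this forces \<open>s = 2\<close>. On an even cycle \<open>s\<close> alternates between two values, and two of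
  the members avoid the cycle, so their \<open>Q k\<close> can be switched between the two alternating classes
  until \<open>s = 2\<close>.
\<close>

section \<open>Unique existence expressed by cardinality\<close>

lemma Collect_singleton_unique:
  assumes "{x \<in> A. P x} = {a}" "x \<in> A" "P x"
  shows "x = a"
proof -
  have "x \<in> {x \<in> A. P x}" using assms(2,3) by simp
  thus ?thesis unfolding assms(1) by simp
qed

lemma ex1_iff_card: "(\<exists>!x. x \<in> A \<and> P x) \<longleftrightarrow> card {x \<in> A. P x} = 1"
proof
  assume "\<exists>!x. x \<in> A \<and> P x"
  then obtain a where "a \<in> A \<and> P a" "\<forall>x. x \<in> A \<and> P x \<longrightarrow> x = a" by (rule ex1E)
  hence "{x \<in> A. P x} = {a}" by blast
  thus "card {x \<in> A. P x} = 1" by simp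
next
  assume "card {x \<in> A. P x} = 1"
  then obtain a where a: "{x \<in> A. P x} = {a}" by (auto simp: card_1_singleton_iff)
  hence "a \<in> A \<and> P a" by blast
  thus "\<exists>!x. x \<in> A \<and> P x" by (rule ex1I) (use Collect_singleton_unique[OF a] in blast)
qed

section \<open>Cycles in finite two-regular multigraphs\<close>

definition two_regular :: "('v, 'e) graph \<Rightarrow> bool" where
  "two_regular H \<longleftrightarrow> wf_graph H \<and> (\<forall>v\<in>verts H. card {e \<in> edges H. v \<in> ends H e} = 2)"

text \<open>Only vertices are required to be distinct; distinctness of the edges follows from it. A
  single vertex without edges is a path, so paths from a given vertex exist.\<close>

definition is_path :: "('v, 'e) graph \<Rightarrow> 'v list \<Rightarrow> 'e list \<Rightarrow> bool" where
  "is_path H vs es \<longleftrightarrow> length vs = Suc (length es) \<and> distinct vs \<and> set vs \<subseteq> verts H \<and>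
     (\<forall>i<length es. es ! i \<in> edges H \<and> ends H (es ! i) = {vs ! i, vs ! Suc i})"

lemma path_extend:
  assumes "is_path H vs es" "f \<in> edges H" "ends H f = {last vs, w}" "w \<in> verts H" "w \<notin> set vs"
  shows "is_path H (vs @ [w]) (es @ [f])"
proof -
  have "vs \<noteq> []" using assms(1) by (auto simp: is_path_def)
  hence "last vs = vs ! length es"
    using assms(1) by (simp add: is_path_def last_conv_nth)
  thus ?thesis using assms unfolding is_path_def
    by (auto simp: nth_append less_Suc_eq)
qed

lemma other_end:
  assumes "wf_graph H" "e \<in> edges H" "v \<in> ends H e"
  obtains w where "w \<noteq> v" "w \<in> verts H" "ends H e = {v, w}"
proof -
  have "card (ends H e) = 2" "ends H e \<subseteq> verts H" using assms by (auto simp: wf_graph_def)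
  then obtain a b where "ends H e = {a, b}" "a \<noteq> b" "a \<in> verts H" "b \<in> verts H"
    by (auto simp: card_2_iff)
  thus ?thesis using that assms(3) by fastforce
qed

lemma two_regular_other_edge:
  assumes "two_regular H" "v \<in> verts H"
  obtains f where "f \<in> edges H" "v \<in> ends H f" "f \<noteq> e"
proof -
  have "card {e \<in> edges H. v \<in> ends H e} = 2" using assms by (auto simp: two_regular_def)
  then obtain a b where "{e \<in> edges H. v \<in> ends H e} = {a, b}" "a \<noteq> b" by (auto simp: card_2_iff)
  thus ?thesis using that by blast
qed

lemma two_regular_at_most_two:
  assumes "two_regular H" "v \<in> verts H" "a \<noteq> b"
    "a \<in> edges H" "v \<in> ends H a" "b \<in> edges H" "v \<in> ends H b"
  shows "{e \<in> edges H. v \<in> ends H e} = {a, b}"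
proof -
  have c: "card {e \<in> edges H. v \<in> ends H e} = 2" using assms by (auto simp: two_regular_def)
  have fin: "finite {e \<in> edges H. v \<in> ends H e}" by (rule card_ge_0_finite) (simp add: c)
  have "{a, b} \<subseteq> {e \<in> edges H. v \<in> ends H e}" using assms(4-7) by simp
  hence "{a, b} = {e \<in> edges H. v \<in> ends H e}"
    by (rule card_subset_eq[OF fin]) (simp add: c assms(3))
  thus ?thesis ..
qed

text \<open>Take a longest path starting at \<open>v\<close>. A second edge at its last vertex
  cannot leave the path, and it can only return to \<open>v\<close>, because each inner vertex
  already has both of its edges on the path.\<close>

lemma two_regular_cycle_through:
  assumes H: "two_regular H" and v: "v \<in> verts H"
  obtains vs es where "is_cycle H vs es" "v \<in> set vs"
proof -
  have wf: "wf_graph H" using H by (simp add: two_regular_def)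
  define P where "P m \<longleftrightarrow> (\<exists>vs es. is_path H vs es \<and> hd vs = v \<and> length es = m)" for m
  have P0: "P 0" unfolding P_def is_path_def
    using v by (intro exI[of _ "[v]"] exI[of _ "[]"]) auto
  have bound: "\<forall>m. P m \<longrightarrow> m \<le> card (verts H)"
  proof (intro allI impI)
    fix m assume "P m"
    then obtain vs es where p: "is_path H vs es" "length es = m" by (auto simp: P_def)
    have "card (set vs) \<le> card (verts H)"
      using p wf by (intro card_mono) (auto simp: is_path_def wf_graph_def)
    thus "m \<le> card (verts H)" using p by (simp add: is_path_def distinct_card)
  qed
  define k where "k = (GREATEST m. P m)"
  have "P k" unfolding k_def using P0 bound by (blast intro: GreatestI_nat)
  then obtain vs es where p: "is_path H vs es" and hd: "hd vs = v" and len: "length es = k"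
    by (auto simp: P_def)
  have max: "\<not> P (Suc k)" using Greatest_le_nat[of P "Suc k" "card (verts H)"] bound unfolding k_def
    by (meson not_less_eq_eq order_refl)
  have lvs: "length vs = Suc k" and dvs: "distinct vs" and sub: "set vs \<subseteq> verts H"
    and e: "\<And>i. i < k \<Longrightarrow> es ! i \<in> edges H" "\<And>i. i < k \<Longrightarrow> ends H (es ! i) = {vs ! i, vs ! Suc i}"
    using p len by (auto simp: is_path_def)
  have ne: "vs \<noteq> []" using lvs by auto
  have v0: "vs ! 0 = v" using hd ne by (simp add: hd_conv_nth)
  have last: "last vs = vs ! k" using ne lvs by (simp add: last_conv_nth)
  have no_ext: "w \<in> set vs" if "f \<in> edges H" "ends H f = {vs ! k, w}" "w \<in> verts H" for f w
  proof (rule ccontr)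
    assume "w \<notin> set vs"
    hence "is_path H (vs @ [w]) (es @ [f])" using path_extend[OF p that(1)] that last by simp
    hence "P (Suc k)" unfolding P_def using hd ne len
      by (intro exI[of _ "vs @ [w]"] exI[of _ "es @ [f]"]) auto
    thus False using max by simp
  qed
  have vk: "vs ! k \<in> verts H" using sub lvs nth_mem[of k vs] by auto
  have inj: "i = j" if "vs ! i = vs ! j" "i \<le> k" "j \<le> k" for i j
    using that dvs lvs by (simp add: nth_eq_iff_index_eq)
  \<comment> \<open>For \<open>k = 0\<close> the expression \<open>es ! (k - 1)\<close> is
    unspecified, but any \<open>f\<close> serves then: \<open>w\<close> differs from the only vertex
    of the path, which the proof of \<open>ik\<close> turns into a contradiction.\<close>
  obtain f where f: "f \<in> edges H" "vs ! k \<in> ends H f" "f \<noteq> (es ! (k - 1))"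
    using two_regular_other_edge[OF H vk] .
  obtain w where w: "w \<noteq> vs ! k" "w \<in> verts H" "ends H f = {vs ! k, w}"
    using other_end[OF wf f(1,2)] .
  then obtain i where i: "i \<le> k" "vs ! i = w"
    using no_ext[OF f(1) w(3,2)] lvs unfolding in_set_conv_nth by (metis less_Suc_eq_le)
  have ik: "i < k" using i w(1) by (cases "i = k") auto
  have f_new: "f \<noteq> es ! j" if "j < k" for j
  proof
    assume "f = es ! j"
    hence "vs ! k \<in> {vs ! j, vs ! Suc j}" using e(2)[OF that] f by simp
    hence "k = Suc j" using inj[of k j] inj[of k "Suc j"] that by auto
    thus False using f(3) \<open>f = es ! j\<close> by simp
  qed
  \<comment> \<open>At an inner vertex \<open>vs ! i\<close> the path edges \<open>es ! j\<close>
    and \<open>es ! i\<close> exhaust the degree, so \<open>f\<close> would be a third edge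
    there.\<close>
  have "i = 0"
  proof (rule ccontr)
    assume "i \<noteq> 0"
    then obtain j where j: "i = Suc j" by (cases i) auto
    have "es ! j \<noteq> es ! i"
    proof
      assume "es ! j = es ! i"
      hence "vs ! j \<in> {vs ! i, vs ! Suc i}" using e(2)[of j] e(2)[of i] ik j by auto
      thus False using inj[of j i] inj[of j "Suc i"] ik j by auto
    qed
    moreover have "vs ! i \<in> verts H" using i w by simp
    ultimately have "{e \<in> edges H. vs ! i \<in> ends H e} = {es ! j, es ! i}"
      using e[of j] e[of i] ik j by (intro two_regular_at_most_two[OF H]) auto
    hence "f \<in> {es ! j, es ! i}" using f(1) w(3) i(2) by blast
    thus False using f_new[of j] f_new[of i] ik j by auto
  qed
  have es_inj: "a = b" if "es ! a = es ! b" "a < k" "b < k" for a b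
  proof -
    have "{vs ! a, vs ! Suc a} = {vs ! b, vs ! Suc b}" using that e(2) by metis
    hence "vs ! a = vs ! b \<or> vs ! a = vs ! Suc b \<and> vs ! Suc a = vs ! b" by (auto simp: doubleton_eq_iff)
    thus ?thesis using inj[of a b] inj[of a "Suc b"] inj[of "Suc a" b] that by auto
  qed
  \<comment> \<open>The closing edge comes last, as it joins \<open>vs ! k\<close> to
    \<open>vs ! 0\<close>. For \<open>k = 1\<close> it is parallel to \<open>es ! 0\<close> and the
    cycle has length 2.\<close>
  have "is_cycle H vs (es @ [f])"
    unfolding is_cycle_def
  proof (intro conjI allI impI)
    show "2 \<le> length vs" using ik lvs by simp
    show "length (es @ [f]) = length vs" using len lvs by simp
    show "distinct vs" by fact
    show "distinct (es @ [f])" using es_inj f_new len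
      by (auto simp: distinct_conv_nth in_set_conv_nth nth_append)
    show "set vs \<subseteq> verts H" by fact
    show "set (es @ [f]) \<subseteq> edges H" using e(1) f(1) len by (auto simp: in_set_conv_nth)
    fix a assume "a < length vs"
    then consider "a < k" | "a = k" using lvs by linarith
    thus "ends H ((es @ [f]) ! a) = {vs ! a, vs ! (Suc a mod length vs)}"
    proof cases
      case 1
      thus ?thesis using e(2)[of a] lvs len by (simp add: nth_append)
    next
      case 2
      thus ?thesis using w(3) i \<open>i = 0\<close> lvs len by (simp add: nth_append)
    qed
  qed
  thus ?thesis using that v0 ne nth_mem[of 0 vs] by auto
qed

text \<open>The index before \<open>j\<close> modulo \<open>n\<close>; zero is treated separately
  because subtraction on \<open>nat\<close> truncates.\<close>

definition cyc_pred :: "nat \<Rightarrow> nat \<Rightarrow> nat" where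
  "cyc_pred n j = (if j = 0 then n - 1 else j - 1)"

text \<open>The edge leaving \<open>vs ! j\<close> and the edge entering it are distinct list
  entries, even on a cycle of length 2, so they use up the degree of that vertex.\<close>

lemma cycle_edges_at:
  assumes H: "two_regular H" and c: "is_cycle H vs es" and j: "j < length vs"
  shows "es ! j \<noteq> es ! cyc_pred (length vs) j"
    and "{e \<in> edges H. vs ! j \<in> ends H e} = {es ! j, es ! cyc_pred (length vs) j}"
proof -
  let ?n = "length vs"
  let ?p = "cyc_pred ?n j"
  have n: "?n \<ge> 2" "length es = ?n" "distinct es" using c by (auto simp: is_cycle_def)
  have p: "?p < ?n" "?p \<noteq> j" "Suc ?p mod ?n = j" using n(1) j by (auto simp: cyc_pred_def)
  show ne: "es ! j \<noteq> es ! ?p" using n p j by (simp add: nth_eq_iff_index_eq)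
  have "vs ! j \<in> ends H (es ! j)" "vs ! j \<in> ends H (es ! ?p)"
    using c j p unfolding is_cycle_def by auto
  moreover have "es ! j \<in> edges H" "es ! ?p \<in> edges H" "vs ! j \<in> verts H"
    using c j p unfolding is_cycle_def by (auto intro: subsetD[OF _ nth_mem])
  ultimately show "{e \<in> edges H. vs ! j \<in> ends H e} = {es ! j, es ! ?p}"
    using two_regular_at_most_two[OF H _ ne] by auto
qed

text \<open>Both edges at a vertex of the cycle belong to the cycle, so no edge leads out of
  it.\<close>

lemma cycle_closed:
  assumes H: "two_regular H" and c: "is_cycle H vs es"
    and e: "e \<in> edges H" "v \<in> ends H e" "v \<in> set vs"
  shows "e \<in> set es" and "ends H e \<subseteq> set vs"
proof -
  obtain j where j: "j < length vs" "v = vs ! j" using e by (auto simp: in_set_conv_nth)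
  have "cyc_pred (length vs) j < length vs" using j by (auto simp: cyc_pred_def)
  hence "{es ! j, es ! cyc_pred (length vs) j} \<subseteq> set es"
    using c j(1) by (simp add: is_cycle_def)
  thus es: "e \<in> set es" using cycle_edges_at(2)[OF H c j(1)] e(1,2) j(2) by blast
  then obtain i where i: "i < length vs" "e = es ! i" using c by (auto simp: in_set_conv_nth is_cycle_def)
  hence "ends H e = {vs ! i, vs ! (Suc i mod length vs)}" using c by (simp add: is_cycle_def)
  moreover have "Suc i mod length vs < length vs" using i(1) by (intro mod_less_divisor) linarith
  ultimately show "ends H e \<subseteq> set vs" using i by auto
qed

text \<open>Walk along the first cycle from the common vertex: by \<open>cycle_closed\<close> no
  step leaves the second cycle. Applied in both directions, this shows that cycles that meet have
  the same vertices.\<close>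

lemma cycle_subset_if_meet:
  assumes H: "two_regular H" and c: "is_cycle H vs es" and c': "is_cycle H vs' es'"
    and v: "v \<in> set vs" "v \<in> set vs'"
  shows "set vs \<subseteq> set vs'"
proof -
  let ?n = "length vs"
  obtain j where j: "j < ?n" "v = vs ! j" using v by (auto simp: in_set_conv_nth)
  have step: "vs ! ((j + t) mod ?n) \<in> set vs'" for t
  proof (induction t)
    case 0 thus ?case using j v by simp
  next
    case (Suc t)
    let ?i = "(j + t) mod ?n"
    have i: "?i < ?n" using j(1) by (intro mod_less_divisor) linarith
    have "ends H (es ! ?i) = {vs ! ?i, vs ! (Suc ?i mod ?n)}" "es ! ?i \<in> edges H"
      using c i unfolding is_cycle_def by (auto intro: subsetD[OF _ nth_mem])
    hence "vs ! (Suc ?i mod ?n) \<in> set vs'"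
      using cycle_closed(2)[OF H c' _ _ Suc] by auto
    thus ?case by (simp add: mod_Suc_eq)
  qed
  show ?thesis
  proof
    fix w assume "w \<in> set vs"
    then obtain i where i: "i < ?n" "w = vs ! i" by (auto simp: in_set_conv_nth)
    \<comment> \<open>Walking \<open>?n - j\<close> steps leads from \<open>j\<close> to index 0,
      and \<open>i\<close> more steps lead to \<open>i\<close>.\<close>
    have "(j + (?n - j + i)) mod ?n = i" using i j by simp
    thus "w \<in> set vs'" using step[of "?n - j + i"] i by simp
  qed
qed

text \<open>This turns a degree at a vertex into a sum over two consecutive edges, the form needed
  for alternating sums.\<close>

lemma card_cycle_edges_at:
  assumes H: "two_regular H" and c: "is_cycle H vs es" and j: "j < length vs" and Q: "Q \<subseteq> edges H"
  shows "card {e \<in> Q. vs ! j \<in> ends H e}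
    = of_bool (es ! j \<in> Q) + of_bool (es ! cyc_pred (length vs) j \<in> Q)"
proof -
  have "{e \<in> Q. vs ! j \<in> ends H e} = Q \<inter> {e \<in> edges H. vs ! j \<in> ends H e}" using Q by auto
  also have "\<dots> = Q \<inter> {es ! j, es ! cyc_pred (length vs) j}" using cycle_edges_at(2)[OF H c j] by simp
  finally show ?thesis using cycle_edges_at(1)[OF H c j] by (auto simp: Int_insert_right)
qed

section \<open>Alternating sums and alternating classes on a cycle\<close>

text \<open>Each value determines the next one. The instance at index 0, which wraps around, only
  serves to bound \<open>s (es ! 0)\<close> by \<open>m\<close>, so that the subtraction is not
  truncated.\<close>

lemma alternating_sum:
  fixes s :: "'e \<Rightarrow> nat"
  assumes s: "\<And>j. j < n \<Longrightarrow> s (es ! j) + s (es ! cyc_pred n j) = m"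
    and i: "i < n"
  shows "s (es ! i) = (if even i then s (es ! 0) else m - s (es ! 0))"
  using i
proof (induction i)
  case (Suc i)
  have "s (es ! Suc i) + s (es ! i) = m" using s[OF Suc.prems] by (simp add: cyc_pred_def)
  moreover have "s (es ! 0) \<le> m"
    using s[of 0] Suc.prems by (cases n) auto
  ultimately show ?case using Suc by (auto split: if_splits)
qed auto

text \<open>On an odd cycle the first and the last edge have indices of equal parity and hence equal
  values, but they are also consecutive, so this value is half of \<open>m\<close>.\<close>

lemma odd_cycle_alternating_sum:
  fixes s :: "'e \<Rightarrow> nat"
  assumes c: "is_cycle H vs es" and odd: "odd (length vs)"
    and s: "\<And>j. j < length vs \<Longrightarrow> s (es ! j) + s (es ! cyc_pred (length vs) j) = m"
    and e: "e \<in> set es"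
  shows "2 * s e = m"
proof -
  have n: "length vs \<ge> 2" using c by (simp add: is_cycle_def)
  hence "length vs - 1 < length vs" "even (length vs - 1)" "0 < length vs" using odd by auto
  hence "s (es ! (length vs - 1)) = s (es ! 0)"
    using alternating_sum[where s = s, OF s, of "length vs - 1"] by simp
  hence z: "2 * s (es ! 0) = m" using s[of 0] \<open>0 < length vs\<close> by (simp add: cyc_pred_def)
  obtain i where "i < length vs" "e = es ! i" using e c by (auto simp: in_set_conv_nth is_cycle_def)
  thus ?thesis using alternating_sum[where s = s, OF s, of i] z by auto
qed

text \<open>On an even cycle these are its two perfect matchings; \<open>True\<close> selects the
  even indices.\<close>

definition parity_class :: "'e list \<Rightarrow> bool \<Rightarrow> 'e set" where
  "parity_class es b = {es ! i | i. i < length es \<and> even i = b}"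

lemma nth_mem_parity_class:
  assumes "distinct es" "i < length es"
  shows "es ! i \<in> parity_class es b \<longleftrightarrow> even i = b"
proof
  assume "es ! i \<in> parity_class es b"
  then obtain j where "es ! i = es ! j" "j < length es" "even j = b" unfolding parity_class_def by blast
  thus "even i = b" using assms by (simp add: nth_eq_iff_index_eq)
qed (use assms in \<open>auto simp: parity_class_def\<close>)

text \<open>When the length is even, an index and its cyclic predecessor have opposite parities,
  also across the wrap-around.\<close>

lemma card_parity_class_at:
  assumes H: "two_regular H" and c: "is_cycle H vs es" and ev: "even (length vs)" and v: "v \<in> set vs"
  shows "card {e \<in> parity_class es b. v \<in> ends H e} = 1"
proof -
  obtain j where j: "j < length vs" "v = vs ! j" using v by (auto simp: in_set_conv_nth)
  have n: "length vs \<ge> 2" "length es = length vs" "distinct es" "set es \<subseteq> edges H"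
    using c by (auto simp: is_cycle_def)
  have sub: "parity_class es b \<subseteq> edges H" using n by (auto simp: parity_class_def)
  have p: "cyc_pred (length vs) j < length vs" "even (cyc_pred (length vs) j) = odd j"
    using j n ev by (auto simp: cyc_pred_def)
  show ?thesis
    using card_cycle_edges_at[OF H c j(1) sub] j(1) p n
    by (cases b) (auto simp: nth_mem_parity_class j(2))
qed

text \<open>The members \<open>Z\<close> and \<open>W\<close> saturate the cycle, so each of them may be replaced by either of its
  two alternating classes; this tunes the alternating sum to the constant 2.\<close>

lemma even_cycle_rebalance:
  fixes q :: "nat \<Rightarrow> 'e set" and d :: "nat \<Rightarrow> 'v \<Rightarrow> nat"
  assumes H: "two_regular H" and c: "is_cycle H vs es" and ev: "even (length vs)"
    and q: "\<And>k. k < 4 \<Longrightarrow> q k \<subseteq> set es"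
    and deg: "\<And>k v. k < 4 \<Longrightarrow> v \<in> set vs \<Longrightarrow> card {e \<in> q k. v \<in> ends H e} = d k v"
    and N: "N \<subseteq> edges H"
    and total: "\<And>v. v \<in> set vs \<Longrightarrow> (\<Sum>k<4. d k v) + card {e \<in> N. v \<in> ends H e} = 4"
    and ZW: "Z < 4" "W < 4" "Z \<noteq> W"
    and dZ: "\<And>v. v \<in> set vs \<Longrightarrow> d Z v = 1" and dW: "\<And>v. v \<in> set vs \<Longrightarrow> d W v = 1"
  obtains q' where "\<And>k. k < 4 \<Longrightarrow> q' k \<subseteq> set es"
    "\<And>k v. k < 4 \<Longrightarrow> v \<in> set vs \<Longrightarrow> card {e \<in> q' k. v \<in> ends H e} = d k v"
    "\<And>e. e \<in> set es \<Longrightarrow> (\<Sum>k<4. of_bool (e \<in> q' k)) + of_bool (e \<in> N) = (2 :: nat)"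
proof -
  have n: "length vs \<ge> 2" "length es = length vs" "distinct es" "set es \<subseteq> edges H"
    using c by (auto simp: is_cycle_def)
  define R where "R = {..<4} - {Z, W}"
  \<comment> \<open>\<open>y\<close> is the load that an edge receives from \<open>N\<close> and
    from all members other than \<open>Z\<close> and \<open>W\<close>.\<close>
  define y where "y e = (\<Sum>k\<in>R. of_bool (e \<in> q k)) + (of_bool (e \<in> N) :: nat)" for e
  have split: "(\<Sum>k<4. g k) = (\<Sum>k\<in>R. g k) + g Z + g W" for g :: "nat \<Rightarrow> nat"
  proof -
    have "{..<4} = insert Z (insert W R)" "finite R" "Z \<notin> insert W R" "W \<notin> R"
      using ZW by (auto simp: R_def)
    thus ?thesis by simp
  qed
  \<comment> \<open>\<open>Z\<close> and \<open>W\<close> each contribute 1 to the total 4 at a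
    vertex, which leaves 2 for \<open>y\<close>.\<close>
  have y: "y (es ! j) + y (es ! cyc_pred (length vs) j) = 2" if j: "j < length vs" for j
  proof -
    have v: "vs ! j \<in> set vs" using j by simp
    have "(\<Sum>k\<in>R. d k (vs ! j))
      = (\<Sum>k\<in>R. of_bool (es ! j \<in> q k) + of_bool (es ! cyc_pred (length vs) j \<in> q k))"
    proof (rule sum.cong[OF refl])
      fix k assume "k \<in> R"
      hence "k < 4" by (simp add: R_def)
      thus "d k (vs ! j) = of_bool (es ! j \<in> q k) + of_bool (es ! cyc_pred (length vs) j \<in> q k)"
        using deg[OF _ v] card_cycle_edges_at[OF H c j, of "q k"] q[of k] n(4) by simp
    qed
    thus ?thesis
      using total[OF v] split[of "\<lambda>k. d k (vs ! j)"] dZ[OF v] dW[OF v] card_cycle_edges_at[OF H c j N]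
      by (simp add: y_def sum.distrib)
  qed
  define y0 where "y0 = y (es ! 0)"
  have y0: "y0 \<le> 2" using y[of 0] n by (cases "length vs") (auto simp: y0_def)
  \<comment> \<open>The load is \<open>y0\<close> on even indices and \<open>2 - y0\<close> on odd
    ones. For \<open>y0 = 0\<close> both \<open>Z\<close> and \<open>W\<close> take the even class,
    for \<open>y0 = 1\<close> they take one class each, and for \<open>y0 = 2\<close> both take the
    odd class.\<close>
  define q' where "q' k = (if k = Z then parity_class es (y0 \<le> 1)
    else if k = W then parity_class es (y0 = 0) else q k)" for k
  show ?thesis
  proof
    fix k :: nat assume k: "k < 4"
    show "q' k \<subseteq> set es" using q[OF k] by (auto simp: q'_def parity_class_def)
    fix v assume v: "v \<in> set vs"
    show "card {e \<in> q' k. v \<in> ends H e} = d k v"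
      using deg[OF k v] dZ[OF v] dW[OF v] card_parity_class_at[OF H c ev v] by (simp add: q'_def)
  next
    fix e assume "e \<in> set es"
    then obtain i where i: "i < length vs" "e = es ! i" using n by (auto simp: in_set_conv_nth)
    have "(\<Sum>k\<in>R. of_bool (e \<in> q' k)) = (\<Sum>k\<in>R. of_bool (e \<in> q k) :: nat)"
      by (rule sum.cong) (auto simp: R_def q'_def)
    moreover have ye: "y e = (if even i then y0 else 2 - y0)"
      using alternating_sum[where s = y, OF y i(1)] i by (simp add: y0_def)
    moreover have "of_bool (e \<in> q' Z) = (of_bool (even i = (y0 \<le> 1)) :: nat)"
      "of_bool (e \<in> q' W) = (of_bool (even i = (y0 = 0)) :: nat)"
      using i n ZW(3) by (auto simp: q'_def nth_mem_parity_class)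
    ultimately have "(\<Sum>k<4. of_bool (e \<in> q' k)) + of_bool (e \<in> N)
      = y e + of_bool (even i = (y0 \<le> 1)) + of_bool (even i = (y0 = 0))"
      unfolding split y_def by simp
    moreover have "y0 = 0 \<or> y0 = 1 \<or> y0 = 2" using y0 by linarith
    ultimately show "(\<Sum>k<4. of_bool (e \<in> q' k)) + of_bool (e \<in> N) = (2 :: nat)"
      unfolding ye by (cases "even i") auto
  qed
qed

section \<open>F-families indexed by 0 to 3\<close>

text \<open>Indices keep empty members apart, although these coincide as sets. \<open>MF k\<close>
  is a perfect matching witnessing that \<open>F k\<close> is balanced.\<close>

locale indexed_F_family =
  fixes G :: "('v, 'e) graph" and M :: "'e set" and F MF :: "nat \<Rightarrow> 'e set"
  assumes wf: "wf_graph G" and cubic: "cubic G" and pmM: "perfect_matching G M"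
    and pmF: "\<And>k. k < 4 \<Longrightarrow> perfect_matching G (MF k)"
    and F_eq: "\<And>k. k < 4 \<Longrightarrow> F k = M \<inter> MF k"
    and disj: "\<And>k l. k < 4 \<Longrightarrow> l < 4 \<Longrightarrow> k \<noteq> l \<Longrightarrow> F k \<inter> F l = {}"
    and odd_cond: "\<And>vs es k. is_cycle (delete_edges G M) vs es \<Longrightarrow> odd (length vs) \<Longrightarrow> k < 4 \<Longrightarrow>
      card (set vs \<inter> covered G (F k)) = 1"
    and even_cond: "\<And>vs es. is_cycle (delete_edges G M) vs es \<Longrightarrow> even (length vs) \<Longrightarrow>
      set vs \<inter> covered G (\<Union>k<4. F k) \<noteq> {} \<Longrightarrow>
      card (set vs \<inter> covered G (\<Union>k<4. F k)) = 4 \<and>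
      ((\<exists>k<4. \<exists>l<4. k \<noteq> l \<and> card (set vs \<inter> covered G (F k)) = 2 \<and> card (set vs \<inter> covered G (F l)) = 2)
        \<or> (\<exists>k<4. card (set vs \<inter> covered G (F k)) = 4))"
    and N_cond: "\<And>vs es. is_cycle (delete_edges G M) vs es \<Longrightarrow>
      odd (length vs) \<or> set vs \<inter> covered G (\<Union>k<4. F k) \<noteq> {} \<Longrightarrow>
      \<exists>N. perfect_matching (induced_subgraph G (set vs \<inter> covered G (\<Union>k<4. F k))) N"
begin

abbreviation "H \<equiv> delete_edges G M"
abbreviation "U \<equiv> \<Union>k<4. F k"

lemma H_simps: "verts H = verts G" "edges H = edges G - M" "ends H = ends G"
  by (auto simp: delete_edges_def)

lemma M_edges: "M \<subseteq> edges G" using pmM by (simp add: perfect_matching_def)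

lemma F_sub_M: "k < 4 \<Longrightarrow> F k \<subseteq> M" using F_eq by auto

lemma end_in_verts: "e \<in> edges G \<Longrightarrow> v \<in> ends G e \<Longrightarrow> v \<in> verts G"
  using wf by (auto simp: wf_graph_def)

lemma pm_unique:
  assumes "perfect_matching G P" "e \<in> P" "e' \<in> P" "v \<in> ends G e" "v \<in> ends G e'"
  shows "e = e'"
proof -
  have "v \<in> verts G" using assms end_in_verts by (auto simp: perfect_matching_def)
  thus ?thesis using assms by (auto simp: perfect_matching_def)
qed

lemma M_unique: "e \<in> M \<Longrightarrow> e' \<in> M \<Longrightarrow> v \<in> ends G e \<Longrightarrow> v \<in> ends G e' \<Longrightarrow> e = e'"
  using pm_unique[OF pmM] .

text \<open>A vertex lies on only one edge of \<open>M\<close>, and that edge lies in at most one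
  member.\<close>

lemma covered_F_disjoint:
  assumes "k < 4" "l < 4" "k \<noteq> l" shows "covered G (F k) \<inter> covered G (F l) = {}"
proof -
  have False if "e \<in> F k" "e' \<in> F l" "v \<in> ends G e" "v \<in> ends G e'" for e e' v
    using M_unique[of e e' v] that F_sub_M assms disj[OF assms] by blast
  thus ?thesis by (auto simp: covered_def)
qed

lemma covered_U: "covered G U = (\<Union>k<4. covered G (F k))"
  by (auto simp: covered_def)

lemma two_regular_H: "two_regular H"
  unfolding two_regular_def H_simps
proof (intro conjI ballI)
  show "wf_graph H" using wf by (auto simp: wf_graph_def H_simps)
  fix v assume v: "v \<in> verts G"
  obtain m where m: "m \<in> M" "v \<in> ends G m" using pmM v by (auto simp: perfect_matching_def)
  have "{e \<in> edges G - M. v \<in> ends G e} = {e \<in> edges G. v \<in> ends G e} - {m}"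
    using m M_unique by blast
  moreover have "card {e \<in> edges G. v \<in> ends G e} = 3" using cubic v by (simp add: cubic_def)
  ultimately show "card {e \<in> edges G - M. v \<in> ends G e} = 2"
    using m M_edges by (simp add: card_Diff_singleton subset_iff)
qed

text \<open>This provides the part of \<open>N\<close> on one cycle. Its edges are edges of the
  cycle or chords from \<open>M\<close>. On a cycle that \<open>U\<close> does not touch it is
  empty.\<close>

lemma cycle_N:
  assumes c: "is_cycle H vs es"
  obtains N where "N \<subseteq> edges G" "\<And>e. e \<in> N \<Longrightarrow> ends G e \<subseteq> set vs \<inter> covered G U"
    "\<And>v. v \<in> set vs \<Longrightarrow> card {e \<in> N. v \<in> ends G e} = of_bool (v \<in> covered G U)"
proof (cases "set vs \<inter> covered G U = {}")
  case True
  show ?thesis by (rule that[of "{}"]) (use True in auto)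
next
  case False
  let ?S = "set vs \<inter> covered G U"
  obtain N where N: "perfect_matching (induced_subgraph G ?S) N" using N_cond[OF c] False by blast
  have sub: "N \<subseteq> {e \<in> edges G. ends G e \<subseteq> ?S}"
    and ex: "\<And>v. v \<in> verts G \<inter> ?S \<Longrightarrow> \<exists>!e. e \<in> N \<and> v \<in> ends G e"
    using N by (auto simp: perfect_matching_def induced_subgraph_def)
  show ?thesis
  proof (rule that[of N])
    fix v assume v: "v \<in> set vs"
    have vG: "v \<in> verts G" using v c by (auto simp: is_cycle_def H_simps)
    show "card {e \<in> N. v \<in> ends G e} = of_bool (v \<in> covered G U)"
    proof (cases "v \<in> covered G U")
      case True
      hence "\<exists>!e. e \<in> N \<and> v \<in> ends G e" using ex[of v] v vG by blast
      thus ?thesis using True unfolding ex1_iff_card by simp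
    next
      case False
      hence "{e \<in> N. v \<in> ends G e} = {}" using sub by auto
      thus ?thesis using False by (simp only: card.empty) simp
    qed
  qed (use sub in auto)
qed

end

section \<open>Choosing the matchings on a single cycle\<close>

locale cycle_with_N = indexed_F_family G M F MF
  for G :: "('v, 'e) graph" and M F MF +
  fixes vs :: "'v list" and es :: "'e list" and N :: "'e set"
  assumes c: "is_cycle H vs es" and N_edges: "N \<subseteq> edges G"
    and N_ends: "\<And>e. e \<in> N \<Longrightarrow> ends G e \<subseteq> set vs \<inter> covered G U"
    and N_card: "\<And>v. v \<in> set vs \<Longrightarrow> card {e \<in> N. v \<in> ends G e} = of_bool (v \<in> covered G U)"
begin

lemma N_at:
  assumes "v \<in> set vs" "v \<in> covered G U"
  obtains g where "{e \<in> N. v \<in> ends G e} = {g}"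
  using N_card[OF assms(1)] assms(2) by (auto simp: card_1_singleton_iff)

lemma es_edges: "set es \<subseteq> edges G - M" using c by (auto simp: is_cycle_def H_simps)

lemma mem_es: "e \<in> edges G - M \<Longrightarrow> v \<in> ends G e \<Longrightarrow> v \<in> set vs \<Longrightarrow> e \<in> set es"
  using cycle_closed(1)[OF two_regular_H c] by (simp add: H_simps)

lemma es_ends: "e \<in> set es \<Longrightarrow> ends G e \<subseteq> set vs"
proof -
  assume e: "e \<in> set es"
  then obtain i where i: "i < length vs" "e = es ! i" using c by (auto simp: in_set_conv_nth is_cycle_def)
  have "vs ! i \<in> ends G e" using c i by (simp add: is_cycle_def H_simps)
  thus ?thesis using cycle_closed(2)[OF two_regular_H c, of e "vs ! i"] e es_edges i by (auto simp: H_simps)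
qed

lemma ends_two: "e \<in> edges G \<Longrightarrow> card (ends G e) = 2"
  using wf by (simp add: wf_graph_def)

text \<open>Off \<open>covered G U\<close> all four members need a cycle edge and \<open>N\<close>
  has none. At a covered vertex let \<open>e\<close> be the \<open>M\<close>-edge. If
  \<open>e\<close> is in \<open>N\<close>, its member loses it, so again four edges are needed and
  \<open>N - M\<close> has none; otherwise three are needed, and the \<open>N\<close>-edge at
  \<open>v\<close> lies outside \<open>M\<close>.\<close>

lemma total:
  assumes v: "v \<in> set vs"
  shows "(\<Sum>k<4. of_bool (v \<notin> covered G (F k - N))) + card {e \<in> N - M. v \<in> ends G e} = (4::nat)"
proof (cases "v \<in> covered G U")
  case False
  hence "v \<notin> covered G (F k - N)" if "k < 4" for k using that by (auto simp: covered_def)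
  hence "(\<Sum>k<4. of_bool (v \<notin> covered G (F k - N))) = (4::nat)" by simp
  moreover have "{e \<in> N - M. v \<in> ends G e} = {}" using N_ends False by auto
  ultimately show ?thesis by (simp only: card.empty)
next
  case True
  then obtain k0 e where e: "k0 < 4" "e \<in> F k0" "v \<in> ends G e" by (auto simp: covered_def)
  have eM: "e \<in> M" using e F_sub_M by auto
  have *: "v \<in> covered G (F k - N) \<longleftrightarrow> k = k0 \<and> e \<notin> N" if k: "k < 4" for k
  proof
    assume "v \<in> covered G (F k - N)"
    then obtain e' where e': "e' \<in> F k" "e' \<notin> N" "v \<in> ends G e'" by (auto simp: covered_def)
    hence "e' = e" using M_unique[OF _ eM e'(3) e(3)] F_sub_M[OF k] by auto
    thus "k = k0 \<and> e \<notin> N" using e' e disj[OF k e(1)] by blast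
  qed (use e in \<open>auto simp: covered_def\<close>)
  have "(\<Sum>k<4. of_bool (v \<notin> covered G (F k - N))) = (\<Sum>k<4. of_bool (\<not> (k = k0 \<and> e \<notin> N)) :: nat)"
    by (rule sum.cong) (auto simp: *)
  also have "\<dots> = (if e \<in> N then 4 else 3)"
  proof -
    have "k0 \<in> {0, 1, 2, 3}" using e(1) by auto
    thus ?thesis by (auto simp: numeral_eq_Suc lessThan_Suc)
  qed
  finally have s: "(\<Sum>k<4. of_bool (v \<notin> covered G (F k - N))) = (if e \<in> N then 4 else 3 :: nat)" .
  obtain g where g: "{e \<in> N. v \<in> ends G e} = {g}" using N_at[OF v True] .
  have "{e \<in> N - M. v \<in> ends G e} = (if e \<in> N then {} else {g})"
  proof (cases "e \<in> N")
    case True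
    hence "g = e" using Collect_singleton_unique[OF g True e(3)] by simp
    thus ?thesis using g True eM by auto
  next
    case False
    have "g \<notin> M" using M_unique[OF _ eM _ e(3)] g False by blast
    thus ?thesis using g False by auto
  qed
  thus ?thesis using s by simp
qed

text \<open>The edge of \<open>MF k\<close> at \<open>v\<close> lies either in \<open>M\<close>,
  hence in \<open>F k\<close>, or on the cycle. Without chords in \<open>N\<close>, passing from
  \<open>F k\<close> to \<open>F k - N\<close> changes nothing.\<close>

lemma restricted_matchings_degree:
  assumes NM: "N \<inter> M = {}" and k: "k < 4" and v: "v \<in> set vs"
  shows "card {e \<in> MF k \<inter> set es. v \<in> ends G e} = of_bool (v \<notin> covered G (F k - N))"
proof -
  have vG: "v \<in> verts G" using v c by (auto simp: is_cycle_def H_simps)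
  obtain g where g: "g \<in> MF k" "v \<in> ends G g" using pmF[OF k] vG by (auto simp: perfect_matching_def)
  have gE: "g \<in> edges G" using g pmF[OF k] by (auto simp: perfect_matching_def)
  have g1: "e = g" if "e \<in> MF k" "v \<in> ends G e" for e using pm_unique[OF pmF[OF k]] that g by blast
  show ?thesis
  proof (cases "g \<in> M")
    case True
    hence "{e \<in> MF k \<inter> set es. v \<in> ends G e} = {}" using g1 es_edges by blast
    moreover have "v \<in> covered G (F k - N)" using True g NM F_eq[OF k] by (auto simp: covered_def)
    ultimately show ?thesis by simp
  next
    case False
    hence "{e \<in> MF k \<inter> set es. v \<in> ends G e} = {g}" using g1 g mem_es[of g v] gE v by blast
    moreover have "v \<notin> covered G (F k - N)" using False g1 F_eq[OF k] by (auto simp: covered_def)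
    ultimately show ?thesis by simp
  qed
qed

text \<open>A chord of \<open>N\<close> in \<open>M\<close> has a covered end, so it is itself an
  edge of some member; both of its ends would then count for this member, while an odd cycle allows
  only one.\<close>

lemma odd_N_M: "odd (length vs) \<Longrightarrow> N \<inter> M = {}"
proof (rule ccontr)
  assume odd: "odd (length vs)" and "N \<inter> M \<noteq> {}"
  then obtain e where e: "e \<in> N" "e \<in> M" by auto
  obtain a b where ab: "ends G e = {a, b}" "a \<noteq> b"
    using ends_two[of e] e N_edges by (auto simp: card_2_iff)
  have sub: "ends G e \<subseteq> set vs \<inter> covered G U" using N_ends e by auto
  then obtain k e' where k: "k < 4" "e' \<in> F k" "a \<in> ends G e'" using ab by (auto simp: covered_def)
  hence "e \<in> F k" using M_unique[of e e' a] e ab F_sub_M by auto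
  hence "{a, b} \<subseteq> set vs \<inter> covered G (F k)" using sub ab by (auto simp: covered_def)
  moreover have "card (set vs \<inter> covered G (F k)) = 1" using odd_cond[OF c odd k(1)] .
  ultimately show False using ab(2) card_mono[of "set vs \<inter> covered G (F k)" "{a, b}"] by simp
qed

text \<open>One form for all even cycles: \<open>x\<close> and \<open>y\<close> coincide when one
  member covers all four vertices or when the cycle is untouched.\<close>

lemma even_two_members:
  assumes ev: "even (length vs)"
  obtains x y where "x < 4" "y < 4" "even (card (set vs \<inter> covered G (F x)))"
    "even (card (set vs \<inter> covered G (F y)))"
    "set vs \<inter> covered G U \<subseteq> covered G (F x) \<union> covered G (F y)"
proof (cases "set vs \<inter> covered G U = {}")
  case True
  have "set vs \<inter> covered G (F 0) = {}" using True by (force simp: covered_U)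
  thus ?thesis using that[of 0 0] True by auto
next
  case False
  have fin: "finite (set vs \<inter> covered G U)" by simp
  have sub: "set vs \<inter> covered G (F k) \<subseteq> set vs \<inter> covered G U" if "k < 4" for k
    using that by (auto simp: covered_U)
  have c4: "card (set vs \<inter> covered G U) = 4" using even_cond[OF c ev False] by simp
  from even_cond[OF c ev False] consider
    (two) k l where "k < 4" "l < 4" "k \<noteq> l"
      "card (set vs \<inter> covered G (F k)) = 2" "card (set vs \<inter> covered G (F l)) = 2"
    | (four) k where "k < 4" "card (set vs \<inter> covered G (F k)) = 4" by blast
  thus ?thesis
  proof cases
    case two
    have "card ((set vs \<inter> covered G (F k)) \<union> (set vs \<inter> covered G (F l))) = 4"
      using two covered_F_disjoint[OF two(1-3)] by (subst card_Un_disjoint) auto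
    hence "(set vs \<inter> covered G (F k)) \<union> (set vs \<inter> covered G (F l)) = set vs \<inter> covered G U"
      using sub[OF two(1)] sub[OF two(2)] c4 by (intro card_subset_eq[OF fin]) auto
    thus ?thesis using two by (intro that[OF two(1,2)]) auto
  next
    case four
    have "set vs \<inter> covered G (F k) = set vs \<inter> covered G U"
      using sub[OF four(1)] four c4 by (intro card_subset_eq[OF fin]) auto
    thus ?thesis using four by (intro that[OF four(1,1)]) auto
  qed
qed

lemma third_member_empty:
  assumes "x < 4" "y < 4" "set vs \<inter> covered G U \<subseteq> covered G (F x) \<union> covered G (F y)"
    "z < 4" "z \<noteq> x" "z \<noteq> y"
  shows "set vs \<inter> covered G (F z) = {}"
  using assms covered_F_disjoint[of z x] covered_F_disjoint[of z y] covered_U by blast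

text \<open>At least two of the four indices differ from \<open>x\<close> and \<open>y\<close>. They
  play the roles of \<open>Z\<close> and \<open>W\<close> in
  \<open>even_cycle_rebalance\<close>.\<close>

lemma even_free_members:
  assumes ev: "even (length vs)"
  obtains Z W where "Z < 4" "W < 4" "Z \<noteq> W"
    "set vs \<inter> covered G (F Z) = {}" "set vs \<inter> covered G (F W) = {}"
proof -
  obtain x y where xy: "x < 4" "y < 4"
    "set vs \<inter> covered G U \<subseteq> covered G (F x) \<union> covered G (F y)"
    using even_two_members[OF ev] by metis
  have "card ({..<4} - {x, y}) \<ge> 4 - card {x, y}"
    using diff_card_le_card_Diff[of "{x, y}" "{..<4}"] by simp
  moreover have "card {x, y} \<le> 2" by (cases "x = y") auto
  ultimately have "card ({..<4} - {x, y}) \<ge> 2" by linarith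
  then obtain Z W where "Z \<in> {..<4} - {x, y}" "W \<in> {..<4} - {x, y}" "Z \<noteq> W"
    by (auto simp: card_le_Suc_iff numeral_eq_Suc)
  thus ?thesis using that third_member_empty[OF xy] by auto
qed

lemma even_card_member:
  assumes ev: "even (length vs)" and k: "k < 4"
  shows "even (card (set vs \<inter> covered G (F k)))"
proof -
  obtain x y where xy: "x < 4" "y < 4" "even (card (set vs \<inter> covered G (F x)))"
    "even (card (set vs \<inter> covered G (F y)))"
    "set vs \<inter> covered G U \<subseteq> covered G (F x) \<union> covered G (F y)"
    using even_two_members[OF ev] by metis
  consider "k = x" | "k = y" | "k \<noteq> x" "k \<noteq> y" by blast
  thus ?thesis
  proof cases
    case 3
    thus ?thesis using third_member_empty[OF xy(1,2,5) k] by simp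
  qed (use xy in auto)
qed

lemma N_unique:
  assumes "e \<in> N" "f \<in> N" "v \<in> ends G e" "v \<in> ends G f"
  shows "e = f"
proof -
  have "v \<in> set vs" "v \<in> covered G U" using N_ends assms by auto
  then obtain g where g: "{e \<in> N. v \<in> ends G e} = {g}" by (rule N_at)
  show ?thesis using Collect_singleton_unique[OF g] assms by metis
qed

text \<open>When \<open>N\<close> uses a chord \<open>e \<in> M\<close>, at most one edge \<open>f\<close> of \<open>N\<close> lies on the cycle, and parity forces
  both ends of \<open>f\<close> to belong to the same member. After \<open>e\<close> is dropped from its member, an alternating
  class of the cycle with \<open>f\<close> removed serves that member.\<close>

lemma chord_matchings:
  assumes ev: "even (length vs)" and NM: "N \<inter> M \<noteq> {}"
  obtains q where "\<And>k. k < 4 \<Longrightarrow> q k \<subseteq> set es"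
    "\<And>k v. k < 4 \<Longrightarrow> v \<in> set vs \<Longrightarrow> card {e \<in> q k. v \<in> ends G e} = of_bool (v \<notin> covered G (F k - N))"
proof -
  obtain e where e: "e \<in> N" "e \<in> M" using NM by auto
  \<comment> \<open>\<open>S\<close> consists of the two covered vertices that the chord
    \<open>e\<close> does not match.\<close>
  define S where "S = set vs \<inter> covered G U - ends G e"
  have e2: "card (ends G e) = 2" and esub: "ends G e \<subseteq> set vs \<inter> covered G U"
    using ends_two e N_edges N_ends by auto
  have fin_e: "finite (ends G e)" using e2 card.infinite by fastforce
  have "set vs \<inter> covered G U \<noteq> {}"
  proof
    assume "set vs \<inter> covered G U = {}"
    hence "ends G e = {}" using esub by blast
    thus False using e2 by simp
  qed
  hence "card (set vs \<inter> covered G U) = 4" using even_cond[OF c ev] by simp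
  hence S2: "card S = 2" using e2 esub fin_e by (simp add: S_def card_Diff_subset)
  hence finS: "finite S" using card.infinite by fastforce
  have alt: "card {e \<in> parity_class es b. v \<in> ends G e} = 1" if "v \<in> set vs" for b v
    using card_parity_class_at[OF two_regular_H c ev that] by (simp add: H_simps)
  show ?thesis
  proof (cases "N \<subseteq> M")
    case True
    \<comment> \<open>Here the \<open>N\<close>-edge at each covered vertex is its
      \<open>M\<close>-edge, so every member loses all its edges at the cycle, and one alternating
      class serves all four.\<close>
    have "v \<notin> covered G (F k - N)" if k: "k < 4" and v: "v \<in> set vs" for k v
    proof
      assume "v \<in> covered G (F k - N)"
      then obtain g where g: "g \<in> F k" "g \<notin> N" "v \<in> ends G g" by (auto simp: covered_def)
      have "v \<in> covered G U" using g k by (auto simp: covered_def)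
      then obtain h where "{e \<in> N. v \<in> ends G e} = {h}" using N_at[OF v] by blast
      hence "h \<in> N" "v \<in> ends G h" by auto
      hence "h = g" using M_unique[of h g v] True g F_sub_M[OF k] by auto
      thus False using g \<open>h \<in> N\<close> by simp
    qed
    moreover have "parity_class es True \<subseteq> set es" by (auto simp: parity_class_def)
    ultimately show ?thesis using alt by (intro that[of "\<lambda>_. parity_class es True"]) auto
  next
    case False
    then obtain f where f: "f \<in> N" "f \<notin> M" by auto
    \<comment> \<open>Distinct edges of \<open>N\<close> share no vertex, so \<open>f\<close> avoids
      the ends of \<open>e\<close>.\<close>
    have "ends G f \<subseteq> S" using N_ends[OF f(1)] N_unique[OF e(1) f(1)] e(2) f(2) by (auto simp: S_def)
    hence fS: "ends G f = S" using card_subset_eq[OF finS] S2 ends_two f(1) N_edges by auto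
    obtain p where p: "p \<in> S" using S2 by fastforce
    then obtain k where k: "k < 4" "p \<in> covered G (F k)" by (auto simp: S_def covered_U)
    have "f \<in> set es" using mem_es[of f p] f N_edges p fS by (auto simp: S_def)
    then obtain i where i: "i < length es" "f = es ! i" by (auto simp: in_set_conv_nth)
    \<comment> \<open>The parity of \<open>i\<close> selects the alternating class that contains
      \<open>f\<close>.\<close>
    define K where "K = parity_class es (even i)"
    have fK: "f \<in> K" using i by (auto simp: K_def parity_class_def)
    \<comment> \<open>Removing the ends of \<open>e\<close> takes two vertices or none from
      \<open>F k\<close>, so the number of its vertices in \<open>S\<close> stays even. It is
      positive because of \<open>p\<close>, and hence equals 2.\<close>
    have Ssub: "S \<subseteq> covered G (F k)"
    proof -
      have split: "S \<inter> covered G (F k) = set vs \<inter> covered G (F k) - ends G e"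
        using k(1) by (auto simp: S_def covered_U)
      have "even (card (S \<inter> covered G (F k)))"
      proof (cases "e \<in> F k")
        case True
        hence "ends G e \<subseteq> set vs \<inter> covered G (F k)" using esub by (auto simp: covered_def)
        hence "card (S \<inter> covered G (F k)) = card (set vs \<inter> covered G (F k)) - 2"
          unfolding split using fin_e e2 by (simp add: card_Diff_subset)
        thus ?thesis using even_card_member[OF ev k(1)] by simp
      next
        case False
        have "ends G e \<inter> covered G (F k) = {}"
          using False M_unique[OF e(2)] F_sub_M[OF k(1)] by (fastforce simp: covered_def)
        hence "S \<inter> covered G (F k) = set vs \<inter> covered G (F k)" unfolding split by blast
        thus ?thesis using even_card_member[OF ev k(1)] by simp
      qed
      moreover have "card (S \<inter> covered G (F k)) \<noteq> 0" using p k finS by auto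
      moreover have "card (S \<inter> covered G (F k)) \<le> 2" using card_mono[OF finS, of "S \<inter> covered G (F k)"] S2 by simp
      ultimately have "card (S \<inter> covered G (F k)) = 2" by presburger
      hence "S \<inter> covered G (F k) = S" using S2 by (intro card_subset_eq[OF finS]) auto
      thus ?thesis by blast
    qed
    have cov: "v \<in> covered G (F l - N) \<longleftrightarrow> l = k \<and> v \<in> S" if l: "l < 4" and v: "v \<in> set vs" for l v
    proof
      assume "v \<in> covered G (F l - N)"
      then obtain g where g: "g \<in> F l" "g \<notin> N" "v \<in> ends G g" by (auto simp: covered_def)
      have "v \<in> covered G (F l)" using g by (auto simp: covered_def)
      moreover have "v \<notin> ends G e" using M_unique[OF e(2), of g v] g e(1) F_sub_M[OF l] by auto
      ultimately have "v \<in> S" using v l by (auto simp: S_def covered_U)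
      thus "l = k \<and> v \<in> S" using Ssub \<open>v \<in> covered G (F l)\<close> covered_F_disjoint[OF l k(1)] by blast
    next
      assume *: "l = k \<and> v \<in> S"
      then obtain g where g: "g \<in> F k" "v \<in> ends G g" using Ssub by (auto simp: covered_def)
      \<comment> \<open>The only \<open>N\<close>-edge at \<open>v\<close> is \<open>f\<close>,
        which is not in \<open>M\<close>.\<close>
      have "g \<notin> N" using N_unique[of g f v] g * fS f F_sub_M[OF k(1)] by auto
      thus "v \<in> covered G (F l - N)" using g * by (auto simp: covered_def)
    qed
    show ?thesis
    proof (rule that[of "\<lambda>l. if l = k then K - {f} else K"])
      fix l :: nat assume l: "l < 4"
      show "(if l = k then K - {f} else K) \<subseteq> set es" by (auto simp: K_def parity_class_def)
      fix v assume v: "v \<in> set vs"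
      have K1: "card {e \<in> K. v \<in> ends G e} = 1" using alt[OF v] by (simp add: K_def)
      have "card {e \<in> K - {f}. v \<in> ends G e} = of_bool (v \<notin> S)"
      proof (cases "v \<in> S")
        case True
        obtain g where g: "{e \<in> K. v \<in> ends G e} = {g}" using K1 by (auto simp: card_1_singleton_iff)
        have "f = g" using Collect_singleton_unique[OF g fK] True fS by simp
        hence "{e \<in> K - {f}. v \<in> ends G e} = {}" using Collect_singleton_unique[OF g] by blast
        thus ?thesis using True by (simp only: card.empty) simp
      next
        case False
        hence "{e \<in> K - {f}. v \<in> ends G e} = {e \<in> K. v \<in> ends G e}" using fS by blast
        thus ?thesis using K1 False by simp
      qed
      thus "card {e \<in> (if l = k then K - {f} else K). v \<in> ends G e} = of_bool (v \<notin> covered G (F l - N))"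
        using cov[OF l v] K1 by simp
    qed
  qed
qed

text \<open>On an odd cycle the restrictions of \<open>MF k\<close> work directly, since the
  alternating sum is forced. On an even cycle they, or the matchings for a chord, have the right
  degrees and are then rebalanced.\<close>

lemma cycle_matchings:
  obtains q where "\<And>k. k < 4 \<Longrightarrow> q k \<subseteq> set es"
    "\<And>k v. k < 4 \<Longrightarrow> v \<in> set vs \<Longrightarrow> card {e \<in> q k. v \<in> ends G e} = of_bool (v \<notin> covered G (F k - N))"
    "\<And>e. e \<in> set es \<Longrightarrow> (\<Sum>k<4. of_bool (e \<in> q k)) + of_bool (e \<in> N) = (2 :: nat)"
proof (cases "odd (length vs)")
  case odd: True
  have NM: "N \<inter> M = {}" using odd_N_M[OF odd] .
  define q where "q k = MF k \<inter> set es" for k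
  have deg: "card {e \<in> q k. v \<in> ends G e} = of_bool (v \<notin> covered G (F k - N))"
    if "k < 4" "v \<in> set vs" for k v
    using restricted_matchings_degree[OF NM that] by (simp add: q_def)
  define s where "s e = (\<Sum>k<4. of_bool (e \<in> q k)) + (of_bool (e \<in> N) :: nat)" for e
  have s: "s (es ! j) + s (es ! cyc_pred (length vs) j) = 4" if j: "j < length vs" for j
  proof -
    have v: "vs ! j \<in> set vs" using j by simp
    have "N - M \<subseteq> edges H" "N - M = N" using N_edges NM by (auto simp: H_simps)
    hence N: "card {e \<in> N - M. vs ! j \<in> ends G e}
        = of_bool (es ! j \<in> N) + of_bool (es ! cyc_pred (length vs) j \<in> N)"
      using card_cycle_edges_at[OF two_regular_H c j, of N] by (simp add: H_simps)
    have "(\<Sum>k<4. of_bool (vs ! j \<notin> covered G (F k - N)))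
      = (\<Sum>k<4. of_bool (es ! j \<in> q k) + (of_bool (es ! cyc_pred (length vs) j \<in> q k) :: nat))"
    proof (rule sum.cong[OF refl])
      fix k :: nat assume "k \<in> {..<4}"
      thus "of_bool (vs ! j \<notin> covered G (F k - N))
        = of_bool (es ! j \<in> q k) + (of_bool (es ! cyc_pred (length vs) j \<in> q k) :: nat)"
        using deg[OF _ v, of k] card_cycle_edges_at[OF two_regular_H c j, of "q k"] es_edges
        by (simp add: H_simps q_def le_infI2)
    qed
    thus ?thesis using total[OF v] N by (simp add: s_def sum.distrib)
  qed
  show ?thesis
  proof (rule that[of q])
    fix e assume "e \<in> set es"
    hence "2 * s e = 4" using odd_cycle_alternating_sum[where s = s, OF c odd s] by blast
    thus "(\<Sum>k<4. of_bool (e \<in> q k)) + of_bool (e \<in> N) = (2 :: nat)" by (simp add: s_def)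
  qed (use deg in \<open>auto simp: q_def\<close>)
next
  case False
  hence ev: "even (length vs)" by simp
  define d :: "nat \<Rightarrow> 'v \<Rightarrow> nat" where "d k v = of_bool (v \<notin> covered G (F k - N))" for k v
  obtain q where q: "\<And>k. k < 4 \<Longrightarrow> q k \<subseteq> set es"
    "\<And>k v. k < 4 \<Longrightarrow> v \<in> set vs \<Longrightarrow> card {e \<in> q k. v \<in> ends H e} = d k v"
  proof (cases "N \<inter> M = {}")
    case True
    show ?thesis
      using restricted_matchings_degree[OF True] by (intro that[of "\<lambda>k. MF k \<inter> set es"]) (auto simp: d_def H_simps)
  next
    case False
    obtain q where "\<And>k. k < 4 \<Longrightarrow> q k \<subseteq> set es"
      "\<And>k v. k < 4 \<Longrightarrow> v \<in> set vs \<Longrightarrow> card {e \<in> q k. v \<in> ends G e} = of_bool (v \<notin> covered G (F k - N))"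
      using chord_matchings[OF ev False] by blast
    thus ?thesis using that[of q] by (simp add: d_def H_simps)
  qed
  obtain Z W where ZW: "Z < 4" "W < 4" "Z \<noteq> W"
    and Z: "set vs \<inter> covered G (F Z) = {}" and W: "set vs \<inter> covered G (F W) = {}"
    using even_free_members[OF ev] .
  have "d Z v = 1" "d W v = 1" if "v \<in> set vs" for v
    using that Z W by (auto simp: d_def covered_def)
  \<comment> \<open>Rebalancing concerns edges outside \<open>M\<close>, so it is applied to
    \<open>N - M\<close>, which agrees with \<open>N\<close> on the edges of the cycle.\<close>
  moreover have "(\<Sum>k<4. d k v) + card {e \<in> N - M. v \<in> ends H e} = 4" if "v \<in> set vs" for v
    using total[OF that] by (simp add: d_def H_simps)
  moreover have "N - M \<subseteq> edges H" using N_edges by (auto simp: H_simps)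
  ultimately obtain q' where q': "\<And>k. k < 4 \<Longrightarrow> q' k \<subseteq> set es"
    "\<And>k v. k < 4 \<Longrightarrow> v \<in> set vs \<Longrightarrow> card {e \<in> q' k. v \<in> ends H e} = d k v"
    "\<And>e. e \<in> set es \<Longrightarrow> (\<Sum>k<4. of_bool (e \<in> q' k)) + of_bool (e \<in> N - M) = (2 :: nat)"
    using even_cycle_rebalance[where q = q and d = d, OF two_regular_H c ev q _ _ ZW] by blast
  have "e \<in> N - M \<longleftrightarrow> e \<in> N" if "e \<in> set es" for e using that es_edges by auto
  thus ?thesis using that[of q'] q' by (simp add: d_def H_simps)
qed

end

section \<open>Gluing the choices over all cycles\<close>

context indexed_F_family
begin

text \<open>A cycle has many list representations, by rotation and reversal. Its vertex set is
  canonical, and these sets partition the vertices.\<close>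

definition cycle_sets :: "'v set set" where
  "cycle_sets = {set vs | vs es. is_cycle H vs es}"

lemma cycle_setsE:
  assumes "V \<in> cycle_sets"
  obtains vs es where "is_cycle H vs es" "V = set vs"
  using assms by (auto simp: cycle_sets_def)

lemma cycle_sets_cover:
  assumes "v \<in> verts G"
  obtains V where "V \<in> cycle_sets" "v \<in> V"
proof -
  obtain vs es where "is_cycle H vs es" "v \<in> set vs"
    using two_regular_cycle_through[OF two_regular_H] assms H_simps(1) by metis
  thus ?thesis using that[of "set vs"] by (auto simp: cycle_sets_def)
qed

lemma cycle_sets_disjoint:
  assumes V: "V \<in> cycle_sets" "V' \<in> cycle_sets" and v: "v \<in> V" "v \<in> V'"
  shows "V = V'"
proof -
  obtain vs es where c: "is_cycle H vs es" "V = set vs" using cycle_setsE[OF V(1)] .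
  obtain vs' es' where c': "is_cycle H vs' es'" "V' = set vs'" using cycle_setsE[OF V(2)] .
  show ?thesis
    using cycle_subset_if_meet[OF two_regular_H c(1) c'(1), of v]
      cycle_subset_if_meet[OF two_regular_H c'(1) c(1), of v] v c(2) c'(2) by simp
qed

lemma cycle_sets_closed:
  assumes "V \<in> cycle_sets" "e \<in> edges G - M" "v \<in> ends G e" "v \<in> V"
  shows "ends G e \<subseteq> V"
proof -
  obtain vs es where c: "is_cycle H vs es" "V = set vs" using cycle_setsE[OF assms(1)] .
  show ?thesis using cycle_closed(2)[OF two_regular_H c(1), of e v] assms c(2) by (simp add: H_simps)
qed

text \<open>The data for one cycle are stated without lists, so that they can be chosen as functions
  of the vertex set. The edges of the cycle appear as the edges outside \<open>M\<close> with all
  ends in \<open>V\<close>.\<close>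

definition local_cover :: "'v set \<Rightarrow> 'e set \<Rightarrow> (nat \<Rightarrow> 'e set) \<Rightarrow> bool" where
  "local_cover V N q \<longleftrightarrow>
     N \<subseteq> edges G \<and> (\<forall>e\<in>N. ends G e \<subseteq> V \<inter> covered G U) \<and>
     (\<forall>v\<in>V. card {e \<in> N. v \<in> ends G e} = of_bool (v \<in> covered G U)) \<and>
     (\<forall>k<4. q k \<subseteq> edges G - M \<and> (\<forall>e\<in>q k. ends G e \<subseteq> V) \<and>
       (\<forall>v\<in>V. card {e \<in> q k. v \<in> ends G e} = of_bool (v \<notin> covered G (F k - N)))) \<and>
     (\<forall>e\<in>edges G - M. ends G e \<subseteq> V \<longrightarrow>
       (\<Sum>k<4. of_bool (e \<in> q k)) + of_bool (e \<in> N) = (2 :: nat))"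

lemma local_cover_exists:
  assumes "V \<in> cycle_sets"
  shows "\<exists>N q. local_cover V N q"
proof -
  obtain vs es where c: "is_cycle H vs es" and V: "V = set vs"
    using cycle_setsE[OF assms] .
  obtain N where N: "N \<subseteq> edges G" "\<And>e. e \<in> N \<Longrightarrow> ends G e \<subseteq> set vs \<inter> covered G U"
    "\<And>v. v \<in> set vs \<Longrightarrow> card {e \<in> N. v \<in> ends G e} = of_bool (v \<in> covered G U)"
    using cycle_N[OF c] by blast
  interpret cycle_with_N G M F MF vs es N by unfold_locales (use c N in auto)
  obtain q where q: "\<And>k. k < 4 \<Longrightarrow> q k \<subseteq> set es"
    "\<And>k v. k < 4 \<Longrightarrow> v \<in> set vs \<Longrightarrow> card {e \<in> q k. v \<in> ends G e} = of_bool (v \<notin> covered G (F k - N))"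
    "\<And>e. e \<in> set es \<Longrightarrow> (\<Sum>k<4. of_bool (e \<in> q k)) + of_bool (e \<in> N) = (2 :: nat)"
    using cycle_matchings by blast
  have "local_cover V N q"
    unfolding local_cover_def V
  proof (intro conjI ballI allI impI)
    fix e assume e: "e \<in> edges G - M" "ends G e \<subseteq> set vs"
    have "ends G e \<noteq> {}" using ends_two[of e] e(1) by auto
    hence "e \<in> set es" using mem_es[OF e(1)] e(2) by blast
    thus "(\<Sum>k<4. of_bool (e \<in> q k)) + of_bool (e \<in> N) = (2 :: nat)" by (rule q(3))
  next
    fix k :: nat and e assume "k < 4" "e \<in> q k"
    thus "ends G e \<subseteq> set vs" using q(1) es_ends by blast
  next
    fix k :: nat assume "k < 4"
    thus "q k \<subseteq> edges G - M" using q(1) es_edges by blast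
  qed (simp_all only: N q)
  thus ?thesis by blast
qed

lemma perfect_matching_iff_card:
  assumes "P \<subseteq> edges G"
  shows "perfect_matching G P \<longleftrightarrow> (\<forall>v\<in>verts G. card {e \<in> P. v \<in> ends G e} = 1)"
  using assms by (simp add: perfect_matching_def ex1_iff_card)

text \<open>The edges chosen for a cycle end only on that cycle, so each condition at a vertex or at
  an edge outside \<open>M\<close> involves a single cycle, and the unions of the local choices
  satisfy it.\<close>

lemma Fulkerson_covering_exists: "\<exists>P. fulkerson_covering G P"
proof -
  obtain Nf qf where loc: "\<And>V. V \<in> cycle_sets \<Longrightarrow> local_cover V (Nf V) (qf V)"
    using local_cover_exists by metis
  define N where "N = (\<Union>V\<in>cycle_sets. Nf V)"
  define Q where "Q k = (\<Union>V\<in>cycle_sets. qf V k)" for k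
  have NfD: "Nf V \<subseteq> edges G" "\<And>e. e \<in> Nf V \<Longrightarrow> ends G e \<subseteq> V \<inter> covered G U"
    "\<And>v. v \<in> V \<Longrightarrow> card {e \<in> Nf V. v \<in> ends G e} = of_bool (v \<in> covered G U)"
    if "V \<in> cycle_sets" for V
    using loc[OF that] unfolding local_cover_def by blast+
  have qfD: "qf V k \<subseteq> edges G - M" "\<And>e. e \<in> qf V k \<Longrightarrow> ends G e \<subseteq> V"
    "\<And>v. v \<in> V \<Longrightarrow> card {e \<in> qf V k. v \<in> ends G e} = of_bool (v \<notin> covered G (F k - Nf V))"
    if "V \<in> cycle_sets" "k < 4" for V k
    using loc[OF that(1)] that(2) unfolding local_cover_def by blast+
  \<comment> \<open>If \<open>e\<close> was chosen for another cycle, then \<open>v\<close> lies on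
    that cycle too, and the two vertex sets coincide.\<close>
  have N_iff: "e \<in> N \<longleftrightarrow> e \<in> Nf V" if "V \<in> cycle_sets" "v \<in> V" "v \<in> ends G e" for V v e
    using that NfD(2) cycle_sets_disjoint unfolding N_def by blast
  have Q_iff: "e \<in> Q k \<longleftrightarrow> e \<in> qf V k" if "V \<in> cycle_sets" "v \<in> V" "v \<in> ends G e" "k < 4" for V v e k
    using that qfD(2) cycle_sets_disjoint unfolding Q_def by blast
  have N_sub: "N \<subseteq> edges G" using NfD(1) by (auto simp: N_def)
  have Q_sub: "Q k \<subseteq> edges G - M" if "k < 4" for k using qfD(1)[OF _ that] by (auto simp: Q_def)
  have U_sub: "U \<subseteq> M" using F_sub_M by auto
  have ex_end: "\<exists>v. v \<in> ends G e" if "e \<in> edges G" for e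
    using wf that by (fastforce simp: wf_graph_def card_2_iff)
  have NM_U: "e \<in> U" if eN: "e \<in> N" and eM: "e \<in> M" for e
  proof -
    obtain V where V: "V \<in> cycle_sets" "e \<in> Nf V" using eN by (auto simp: N_def)
    obtain v where v: "v \<in> ends G e" using ex_end eM M_edges by blast
    hence "v \<in> covered G U" using NfD(2)[OF V] by blast
    then obtain u where "u \<in> U" "v \<in> ends G u" unfolding covered_def by blast
    thus ?thesis using M_unique[of e u v] eM v U_sub by auto
  qed
  define P where "P i = (if i = 4 then M else if i = 5 then (M - U) \<union> N else (F i - N) \<union> Q i)" for i :: nat
  \<comment> \<open>At a vertex covered by \<open>U\<close> the \<open>M\<close>-edge is dropped and
    replaced by exactly one edge of \<open>N\<close>; elsewhere the \<open>M\<close>-edge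
    stays.\<close>
  have M1: "perfect_matching G ((M - U) \<union> N)"
  proof (subst perfect_matching_iff_card)
    show "(M - U) \<union> N \<subseteq> edges G" using M_edges N_sub by auto
    show "\<forall>v\<in>verts G. card {e \<in> (M - U) \<union> N. v \<in> ends G e} = 1"
    proof
      fix v assume v: "v \<in> verts G"
      obtain V where V: "V \<in> cycle_sets" "v \<in> V" using cycle_sets_cover[OF v] .
      have Nv: "{e \<in> N. v \<in> ends G e} = {e \<in> Nf V. v \<in> ends G e}" using N_iff[OF V] by blast
      obtain m where m: "m \<in> M" "v \<in> ends G m" using pmM v by (auto simp: perfect_matching_def)
      show "card {e \<in> (M - U) \<union> N. v \<in> ends G e} = 1"
      proof (cases "v \<in> covered G U")
        case True
        have "e \<in> U" if "e \<in> M" "v \<in> ends G e" for e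
          using True M_unique[OF that(1)] that(2) U_sub unfolding covered_def by blast
        hence "{e \<in> (M - U) \<union> N. v \<in> ends G e} = {e \<in> Nf V. v \<in> ends G e}" using Nv by blast
        thus ?thesis using NfD(3)[OF V] True by simp
      next
        case False
        have "{e \<in> Nf V. v \<in> ends G e} = {}" using NfD(2)[OF V(1)] False by blast
        moreover have "m \<notin> U" using False m(2) by (auto simp: covered_def)
        ultimately have "{e \<in> (M - U) \<union> N. v \<in> ends G e} = {m}" using Nv M_unique[OF _ m(1) _ m(2)] m by blast
        thus ?thesis by simp
      qed
    qed
  qed
  have MQ: "perfect_matching G ((F k - N) \<union> Q k)" if k: "k < 4" for k
  proof (subst perfect_matching_iff_card)
    show "(F k - N) \<union> Q k \<subseteq> edges G" using F_sub_M[OF k] M_edges Q_sub[OF k] by auto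
    show "\<forall>v\<in>verts G. card {e \<in> (F k - N) \<union> Q k. v \<in> ends G e} = 1"
    proof
      fix v assume v: "v \<in> verts G"
      obtain V where V: "V \<in> cycle_sets" "v \<in> V" using cycle_sets_cover[OF v] .
      have Qv: "{e \<in> Q k. v \<in> ends G e} = {e \<in> qf V k. v \<in> ends G e}" using Q_iff[OF V _ k] by blast
      have cov: "v \<in> covered G (F k - Nf V) \<longleftrightarrow> v \<in> covered G (F k - N)"
        using N_iff[OF V] by (auto simp: covered_def)
      show "card {e \<in> (F k - N) \<union> Q k. v \<in> ends G e} = 1"
      proof (cases "v \<in> covered G (F k - N)")
        case True
        then obtain g where g: "g \<in> F k" "g \<notin> N" "v \<in> ends G g" by (auto simp: covered_def)
        have gM: "g \<in> M" using F_sub_M[OF k] g by auto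
        \<comment> \<open>Cardinality 0 gives emptiness only for finite sets.\<close>
        have "finite (qf V k)" using finite_subset[OF qfD(1)[OF V(1) k]] wf by (auto simp: wf_graph_def)
        hence "{e \<in> qf V k. v \<in> ends G e} = {}" using qfD(3)[OF V(1) k V(2)] True cov by simp
        hence "{e \<in> (F k - N) \<union> Q k. v \<in> ends G e} = {g}"
          using Qv g M_unique[OF _ gM _ g(3)] F_sub_M[OF k] by blast
        thus ?thesis by simp
      next
        case False
        hence "{e \<in> (F k - N) \<union> Q k. v \<in> ends G e} = {e \<in> qf V k. v \<in> ends G e}"
          using Qv by (auto simp: covered_def)
        thus ?thesis using qfD(3)[OF V(1) k V(2)] False cov by simp
      qed
    qed
  qed
  have "perfect_matching G (P i)" if "i < 6" for i
    using that M1 MQ[of i] pmM by (auto simp: P_def)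
  moreover have "card {i. i < 6 \<and> e \<in> P i} = 2" if e: "e \<in> edges G" for e
  proof -
    have six: "{..<6::nat} = insert 5 (insert 4 {..<4})" by auto
    have "card {i. i < 6 \<and> e \<in> P i} = (\<Sum>i<6. of_bool (e \<in> P i))"
      by (simp add: Collect_conj_eq lessThan_def[symmetric])
    also have "\<dots> = of_bool (e \<in> P 5) + of_bool (e \<in> P 4) + (\<Sum>i<4. of_bool (e \<in> P i))"
      unfolding six by simp
    also have "(\<Sum>i<4. of_bool (e \<in> P i)) = (\<Sum>i<4. of_bool (e \<in> (F i - N) \<union> Q i) :: nat)"
      by (rule sum.cong) (auto simp: P_def)
    also have "of_bool (e \<in> P 5) + of_bool (e \<in> P 4) + \<dots> = (2 :: nat)"
    proof (cases "e \<in> M")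
      case True
      have noQ: "e \<notin> Q i" if "i < 4" for i using Q_sub[OF that] True by auto
      show ?thesis
      \<comment> \<open>Besides \<open>P 4\<close>, an edge of \<open>M\<close> lies in the matching
        of its member if it is in \<open>U\<close> but not in \<open>N\<close>, and in
        \<open>P 5\<close> otherwise.\<close>
      proof (cases "e \<in> U \<and> e \<notin> N")
        case True
        then obtain k where k: "k < 4" "e \<in> F k" by auto
        have "(\<Sum>i<4. of_bool (e \<in> (F i - N) \<union> Q i)) = (\<Sum>i<4. of_bool (i = k) :: nat)"
          using k True noQ disj[OF _ k(1)] by (intro sum.cong) auto
        also have "\<dots> = 1" using k(1) by (simp add: of_bool_def sum.delta)
        finally show ?thesis using True \<open>e \<in> M\<close> by (simp add: P_def)
      next
        case False
        have "(\<Sum>i<4. of_bool (e \<in> (F i - N) \<union> Q i)) = (0 :: nat)"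
          using False noQ by (intro sum.neutral) auto
        thus ?thesis using False NM_U[of e] \<open>e \<in> M\<close> by (auto simp: P_def)
      qed
    next
      case False
      \<comment> \<open>An edge outside \<open>M\<close> belongs to one cycle, where the local sum
        is 2; the summand for \<open>N\<close> is its membership in \<open>P 5\<close>.\<close>
      obtain v where v: "v \<in> ends G e" using ex_end[OF e] by blast
      obtain V where V: "V \<in> cycle_sets" "v \<in> V" using cycle_sets_cover[OF end_in_verts[OF e v]] .
      have "ends G e \<subseteq> V" using cycle_sets_closed[OF V(1) _ v V(2)] e False by blast
      hence two: "(\<Sum>k<4. of_bool (e \<in> qf V k)) + of_bool (e \<in> Nf V) = (2 :: nat)"
        using loc[OF V(1)] e False unfolding local_cover_def by blast
      have "(\<Sum>i<4. of_bool (e \<in> (F i - N) \<union> Q i)) = (\<Sum>i<4. of_bool (e \<in> qf V i) :: nat)"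
        using Q_iff[OF V v] False F_sub_M by (intro sum.cong) auto
      thus ?thesis using two N_iff[OF V v] False by (simp add: P_def)
    qed
    finally show ?thesis .
  qed
  ultimately have "fulkerson_covering G P" by (auto simp: fulkerson_covering_def)
  thus ?thesis by blast
qed

end

section \<open>From the members \<open>A\<close>, \<open>B\<close>, \<open>C\<close>,
  \<open>D\<close> to the indexed family\<close>

theorem theorem4p1:
  fixes G :: "('v, 'e) graph" and M A B C D :: "'e set"
  assumes "wf_graph G" and "cubic G" and "bridgeless G"
    and "perfect_matching G M"
    and "F_family G M A B C D"
  shows "\<exists>P. fulkerson_covering G P"
proof -
  define F where "F = (\<lambda>k::nat. [A, B, C, D] ! k)"
  have F_simps: "F 0 = A" "F (Suc 0) = B" "F 2 = C" "F 3 = D" by (auto simp: F_def)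
  have four: "{..<4::nat} = {0, 1, 2, 3}" by auto
  have U: "(\<Union>k<4. F k) = A \<union> B \<union> C \<union> D" unfolding four by (simp add: F_simps Un_assoc)
  have mem: "(X \<in> {A, B, C, D}) = (\<exists>k<4. X = F k)" for X
  proof -
    have "(\<exists>k<4. X = F k) = (\<exists>k\<in>{..<4}. X = F k)" by blast
    thus ?thesis unfolding four by (simp add: F_simps)
  qed
  have bex: "(\<exists>X\<in>{A, B, C, D}. R X) \<longleftrightarrow> (\<exists>k<4. R (F k))" for R
    unfolding Bex_def mem by blast
  note FF = assms(5)[unfolded F_family_def, folded U]
  note bal = FF[THEN conjunct1]
  have dis: "A \<inter> B = {}" "A \<inter> C = {}" "A \<inter> D = {}" "B \<inter> C = {}" "B \<inter> D = {}" "C \<inter> D = {}"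
    using FF by - (elim conjE, assumption)+
  \<comment> \<open>Seven projections skip the balance condition and the six disjointness
    conditions; the three conditions on cycles remain.\<close>
  note cyc = FF[THEN conjunct2, THEN conjunct2, THEN conjunct2, THEN conjunct2, THEN conjunct2,
      THEN conjunct2, THEN conjunct2]
  note odd = cyc[THEN conjunct1, rule_format, OF conjI]
    and even = cyc[THEN conjunct2, THEN conjunct1, rule_format, OF conjI, OF _ conjI]
    and ind = cyc[THEN conjunct2, THEN conjunct2, rule_format, OF conjI]
  have "\<exists>MX. perfect_matching G MX \<and> F k = M \<inter> MX" if "k < 4" for k
  proof -
    have "F k \<in> {A, B, C, D}" using that mem by blast
    hence "balanced_matching G M (F k)" by (rule bspec[OF bal])
    thus ?thesis by (simp add: balanced_matching_def)
  qed
  then obtain MF where MF: "\<And>k. k < 4 \<Longrightarrow> perfect_matching G (MF k) \<and> F k = M \<inter> MF k" by metis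
  have disj: "F k \<inter> F l = {}" if "k < 4" "l < 4" "k \<noteq> l" for k l
  proof -
    have "k \<in> {0, 1, 2, 3}" "l \<in> {0, 1, 2, 3}" using that four by blast+
    thus ?thesis using dis that(3) by (auto simp: F_simps)
  qed
  interpret indexed_F_family G M F MF
  proof unfold_locales
    fix vs es k
    assume a: "is_cycle (delete_edges G M) vs es" "odd (length vs)" and k: "k < (4::nat)"
    have "F k \<in> {A, B, C, D}" using k mem by blast
    thus "card (set vs \<inter> covered G (F k)) = 1" by (rule odd[OF a])
  next
    fix vs es
    assume a: "is_cycle (delete_edges G M) vs es" "even (length vs)"
      "set vs \<inter> covered G (\<Union>k<4. F k) \<noteq> {}"
    show "card (set vs \<inter> covered G (\<Union>k<4. F k)) = 4 \<and>
      ((\<exists>k<4. \<exists>l<4. k \<noteq> l \<and> card (set vs \<inter> covered G (F k)) = 2 \<and>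
          card (set vs \<inter> covered G (F l)) = 2)
        \<or> (\<exists>k<4. card (set vs \<inter> covered G (F k)) = 4))"
      \<comment> \<open>Members that differ as sets have different indices.\<close>
      using even[OF a] unfolding bex by (elim conjE disjE exE; intro conjI; metis)
  next
    fix vs es
    assume "is_cycle (delete_edges G M) vs es"
      "odd (length vs) \<or> set vs \<inter> covered G (\<Union>k<4. F k) \<noteq> {}"
    thus "\<exists>N. perfect_matching (induced_subgraph G (set vs \<inter> covered G (\<Union>k<4. F k))) N"
      by (rule ind)
  qed (rule assms(1,2,4) MF[THEN conjunct1] MF[THEN conjunct2] disj; assumption)+
  show ?thesis by (rule Fulkerson_covering_exists)
qed

end
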